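(* Let $\lambda\in\mathbb{R}$, $\lambda\ne0$, and let $\alpha_1>0$, $\alpha_2>0$ and $\alpha$ be real numbers satisfying $0<\alpha_1+\alpha_2\le\alpha<1$. Then, for $t>0$, $${}_0^{C}\mathrm{D}_t^{\alpha_1}\,{}_0^{C}\mathrm{D}_t^{\alpha_2}E_\alpha(\lambda t^\alpha)={}_0^{C}\mathrm{D}_t^{\alpha_1+\alpha_2}E_\alpha(\lambda t^\alpha)={}_0^{C}\mathrm{D}_t^{\alpha_2}\,{}_0^{C}\mathrm{D}_t^{\alpha_1}E_\alpha(\lambda t^\alpha),$$ even though the function $t\mapsto E_\alpha(\lambda t^\alpha)$ is not $C^1$ at $t=0$.
   Context: $E_\alpha(z)=\sum_{k=0}^\infty \frac{z^k}{\Gamma(\alpha k+1)}$ is the one-parameter Mittag-Leffler function. For $0<\gamma<1$ the Caputo fractional derivative of order $\gamma$ with lower limit $0$ is $${}_0^{C}\mathrm{D}_t^{\gamma}f(t)=\frac{1}{\Gamma(1-\gamma)}\int_0^t(t-\tau)^{-\gamma}f'(\tau)\,d\tau,\qquad t>0,$$ applied to functions $f$ that are continuous on $[0,\infty)$ and absolutely continuous on each $[0,T]$ (in the compositions, the inner derivative is regarded as a function on $[0,\infty)$ by continuous extension to $t=0$). A function is "not $C^1$ at $t=0$" if it does not belong to $C^1[0,T]$ for any $T>0$. *)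

theory Defs
  imports "HOL-Analysis.Analysis"
begin

definition mittag_leffler :: "real \<Rightarrow> 'a::{real_normed_field, banach} \<Rightarrow> 'a" where
  "mittag_leffler \<alpha> z = (\<Sum>k. z ^ k / of_real (Gamma (\<alpha> * real k + 1)))"

text \<open>Absolute continuity of a function (the library's \<open>absolutely_continuous\<close> is about measures).
  A pair \<open>(u, v)\<close> in \<open>D\<close> stands for the open interval from \<open>u\<close> to \<open>v\<close>.\<close>

definition abs_continuous_on :: "real \<Rightarrow> real \<Rightarrow> (real \<Rightarrow> real) \<Rightarrow> bool" where
  "abs_continuous_on a b f \<longleftrightarrow>
     (\<forall>\<epsilon>>0. \<exists>\<delta>>0. \<forall>D. finite D \<longrightarrow>
        (\<forall>(u, v)\<in>D. a \<le> u \<and> u \<le> v \<and> v \<le> b) \<longrightarrow>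
        disjoint_family_on (\<lambda>(u, v). {u<..<v}) D \<longrightarrow>
        (\<Sum>(u, v)\<in>D. v - u) < \<delta> \<longrightarrow>
        (\<Sum>(u, v)\<in>D. \<bar>f v - f u\<bar>) < \<epsilon>)"

text \<open>Functions on the half-line \<open>{0..}\<close> are represented by total functions whose values at
  negative arguments play no role.\<close>

definition caputo_admissible :: "(real \<Rightarrow> real) \<Rightarrow> bool" where
  "caputo_admissible f \<longleftrightarrow> continuous_on {0..} f \<and> (\<forall>T>0. abs_continuous_on 0 T f)"

text \<open>An absolutely continuous function is differentiable only almost everywhere; the arbitrary
  value of \<open>deriv f\<close> on the remaining null set (and at 0) does not affect the Lebesgue integral.
  As \<open>0 powr x = 0\<close>, the singular kernel vanishes at \<open>\<tau> = t\<close>, which is also immaterial.\<close>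

definition caputo :: "real \<Rightarrow> (real \<Rightarrow> real) \<Rightarrow> real \<Rightarrow> real" where
  "caputo \<gamma> f t =
     1 / Gamma (1 - \<gamma>) * (LINT \<tau>:{0..t}|lebesgue. (t - \<tau>) powr (- \<gamma>) * deriv f \<tau>)"

text \<open>The library integral is 0 for a non-integrable integrand, so that the existence of the
  Caputo derivative at all \<open>t > 0\<close> has to be expressed separately.\<close>

definition caputo_exists :: "real \<Rightarrow> (real \<Rightarrow> real) \<Rightarrow> bool" where
  "caputo_exists \<gamma> f \<longleftrightarrow> caputo_admissible f \<and>
     (\<forall>t>0. set_integrable lebesgue {0..t} (\<lambda>\<tau>. (t - \<tau>) powr (- \<gamma>) * deriv f \<tau>))"

text \<open>Extension of a function on \<open>{0<..}\<close> to \<open>{0..}\<close> by its limit at 0. If there is no limit, the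
  value at 0 is unspecified and the result is not continuous on \<open>{0..}\<close>, hence not admissible.\<close>

definition extend0 :: "(real \<Rightarrow> real) \<Rightarrow> real \<Rightarrow> real" where
  "extend0 g t = (if t = 0 then Lim (at_right 0) g else g t)"

text \<open>Membership in \<open>C\<^sup>1[a,b]\<close> with one-sided derivatives at the endpoints; the library's
  \<open>C1_differentiable_on\<close> requires two-sided ones.\<close>

definition C1_on :: "real \<Rightarrow> real \<Rightarrow> (real \<Rightarrow> real) \<Rightarrow> bool" where
  "C1_on a b f \<longleftrightarrow>
     (\<exists>f'. (\<forall>x\<in>{a..b}. (f has_real_derivative f' x) (at x within {a..b})) \<and>
           continuous_on {a..b} f')"

end

theory Submission
  imports Defs
begin

text \<open>
  With \<open>E\<^bsub>\<alpha>,\<beta>\<^esub>(z) = \<Sum>k. z ^ k / \<Gamma>(\<alpha> k + \<beta>)\<close> one has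
  \<open>E\<^bsub>\<alpha>\<^esub>(\<lambda> t\<^sup>\<alpha>) = 1 + \<lambda> t\<^sup>\<alpha> E\<^bsub>\<alpha>,\<alpha>+1\<^esub>(\<lambda> t\<^sup>\<alpha>)\<close>, and the termwise Beta integral shows that
  the Caputo derivative of order \<open>\<gamma>\<close> annihilates the constant and turns
  \<open>t\<^sup>\<beta> E\<^bsub>\<alpha>,\<beta>+1\<^esub>(\<lambda> t\<^sup>\<alpha>)\<close> into the same expression with \<open>\<beta> - \<gamma>\<close> in place of \<open>\<beta>\<close>. As long as the
  exponent stays positive the result is continuous and vanishes at 0, so that no constant term
  arises and the orders of successive derivatives add up. At 0 the difference quotient
  grows like \<open>t\<close> to the power \<open>\<alpha> - 1\<close>.
\<close>

section \<open>Absolute continuity of a function with integrable derivative\<close>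

text \<open>Absolute continuity of the integral, by truncation: \<open>min \<bar>g x\<bar> n\<close>
  contributes at most n times the measure of the set, while the integral of the excess
  \<open>h n\<close> tends to 0 by dominated convergence.\<close>

lemma set_integral_small_of_emeasure_small:
  fixes g :: "'a \<Rightarrow> real"
  assumes g: "integrable M g" and "\<epsilon> > 0"
  obtains \<delta> where "\<delta> > 0"
    and "\<And>A. A \<in> sets M \<Longrightarrow> emeasure M A < ennreal \<delta> \<Longrightarrow> (LINT x:A|M. \<bar>g x\<bar>) < \<epsilon>"
proof -
  define h where "h n x = \<bar>g x\<bar> - min \<bar>g x\<bar> (real n)" for n x
  note [measurable] = borel_measurable_integrable[OF g]
  have hint: "integrable M (h n)" for n
    unfolding h_def using g by (intro Bochner_Integration.integrable_diff integrable_min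
      Bochner_Integration.integrable_bound[OF g, of "\<lambda>x. min \<bar>g x\<bar> (real n)"]) auto
  have "(\<lambda>n. integral\<^sup>L M (h n)) \<longlonglongrightarrow> integral\<^sup>L M (\<lambda>x. 0)"
  proof (rule integral_dominated_convergence[where w = "\<lambda>x. \<bar>g x\<bar>"])
    show "AE x in M. (\<lambda>n. h n x) \<longlonglongrightarrow> 0"
    proof (rule AE_I2)
      fix x
      obtain N where N: "real N \<ge> \<bar>g x\<bar>" using real_arch_simple by blast
      have "eventually (\<lambda>n. h n x = 0) sequentially"
        by (rule eventually_mono[OF eventually_ge_at_top[of N]]) (use N in \<open>auto simp: h_def\<close>)
      then show "(\<lambda>n. h n x) \<longlonglongrightarrow> 0" by (rule tendsto_eventually)
    qed
  qed (use g hint in \<open>auto simp: h_def\<close>)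
  then have "eventually (\<lambda>n. integral\<^sup>L M (h n) < \<epsilon> / 2) sequentially"
    using \<open>\<epsilon> > 0\<close> by (intro order_tendstoD(2)) auto
  then obtain n where n: "integral\<^sup>L M (h n) < \<epsilon> / 2" by (auto simp: eventually_sequentially)
  \<comment> \<open>The bounded part then contributes at most \<epsilon> / 2; the summand 1 keeps
    the denominator positive when n = 0.\<close>
  define \<delta> where "\<delta> = \<epsilon> / (2 * (real n + 1))"
  have "\<delta> > 0" using \<open>\<epsilon> > 0\<close> by (simp add: \<delta>_def)
  moreover have "(LINT x:A|M. \<bar>g x\<bar>) < \<epsilon>" if A[measurable]: "A \<in> sets M" and "emeasure M A < ennreal \<delta>" for A
  proof -
    have fin: "emeasure M A < \<infinity>" using that(2) using ennreal_less_top less_trans by fastforce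
    have mA: "measure M A < \<delta>"
      using that(2) fin \<open>\<delta> > 0\<close>
      by (metis emeasure_eq_ennreal_measure ennreal_less_iff infinity_ennreal_def measure_nonneg order_less_irrefl)
    have "(LINT x:A|M. \<bar>g x\<bar>) \<le> (\<integral>x. h n x + real n * indicator A x \<partial>M)"
      unfolding set_lebesgue_integral_def
    proof (rule integral_mono)
      show "integrable M (\<lambda>x. indicat_real A x *\<^sub>R \<bar>g x\<bar>)"
        using g by (intro integrable_mult_indicator) auto
      show "integrable M (\<lambda>x. h n x + real n * indicat_real A x)"
        using hint fin by (intro Bochner_Integration.integrable_add) auto
    qed (auto simp: h_def indicator_def)
    also have "\<dots> = integral\<^sup>L M (h n) + real n * measure M A"
      using hint fin by (subst Bochner_Integration.integral_add) auto
    also have "real n * measure M A \<le> (real n + 1) * \<delta>"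
      using mA by (intro mult_mono) auto
    also have "(real n + 1) * \<delta> = \<epsilon> / 2" by (simp add: \<delta>_def field_simps)
    finally show ?thesis using n by simp
  qed
  ultimately show ?thesis using that by blast
qed

text \<open>Each increment of \<open>h\<close> is the integral of \<open>h'\<close> over its
  interval, and by disjointness the increments add up to at most the integral of |h'| over a set of
  small measure. Only continuity is asked at the endpoints, because the derivative of
  \<open>t powr \<beta>\<close> is unbounded at 0 for \<beta> < 1.\<close>

lemma abs_continuous_on_integrable_deriv:
  fixes h h' :: "real \<Rightarrow> real"
  assumes cont: "continuous_on {a..b} h"
    and deriv: "\<And>x. x \<in> {a<..<b} \<Longrightarrow> (h has_real_derivative h' x) (at x)"
    and int: "set_integrable lebesgue {a..b} h'"
  shows "abs_continuous_on a b h"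
  unfolding abs_continuous_on_def
proof (intro allI impI)
  fix \<epsilon> :: real assume "\<epsilon> > 0"
  obtain \<delta> where "\<delta> > 0" and \<delta>: "\<And>A. A \<in> sets lebesgue \<Longrightarrow> emeasure lebesgue A < ennreal \<delta> \<Longrightarrow>
      (LINT x:A|lebesgue. \<bar>indicator {a..b} x *\<^sub>R h' x\<bar>) < \<epsilon>"
    using set_integral_small_of_emeasure_small[OF int[unfolded set_integrable_def] \<open>\<epsilon> > 0\<close>] by metis
  have "(\<Sum>(u, v)\<in>D. \<bar>h v - h u\<bar>) < \<epsilon>"
    if "finite D" and D: "\<forall>(u, v)\<in>D. a \<le> u \<and> u \<le> v \<and> v \<le> b"
      and disj: "disjoint_family_on (\<lambda>(u, v). {u<..<v}) D" and len: "(\<Sum>(u, v)\<in>D. v - u) < \<delta>" for D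
  proof -
    define I where "I = (\<lambda>(u, v). {u<..<v::real})"
    have sub: "I p \<subseteq> {a..b}" if "p \<in> D" for p using D that by (auto simp: I_def)
    have meas[simp]: "I p \<in> sets lebesgue" for p by (auto simp: I_def split: prod.split)
    have intI: "set_integrable lebesgue (I p) h'" if "p \<in> D" for p
      by (rule set_integrable_subset[OF int]) (use sub that in auto)
    have intI': "set_integrable lebesgue (I p) (\<lambda>x. \<bar>h' x\<bar>)" if "p \<in> D" for p
      by (rule set_integrable_abs[OF intI[OF that]])
    have "\<bar>h v - h u\<bar> \<le> (LINT x:I (u, v)|lebesgue. \<bar>h' x\<bar>)" if uv: "(u, v) \<in> D" for u v
    proof -
      have *: "a \<le> u" "u \<le> v" "v \<le> b" using D uv by auto
      \<comment> \<open>The fundamental theorem yields a gauge integral; absolute integrability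
        identifies it with the Lebesgue integral below.\<close>
      have "(h' has_integral (h v - h u)) {u..v}"
      proof (rule fundamental_theorem_of_calculus_interior)
        show "continuous_on {u..v} h" by (rule continuous_on_subset[OF cont]) (use * in auto)
        show "(h has_vector_derivative h' x) (at x)" if "x \<in> {u<..<v}" for x
          using deriv[of x] that * by (simp add: has_real_derivative_iff_has_vector_derivative)
      qed fact
      then have "(h' has_integral (h v - h u)) (I (u, v))"
        by (simp add: I_def has_integral_Icc_iff_Ioo)
      then have "h v - h u = (LINT x:I (u, v)|lebesgue. h' x)"
        using set_lebesgue_integral_eq_integral(2)[OF intI[OF uv]] by (simp add: integral_unique)
      also have "\<bar>\<dots>\<bar> \<le> (LINT x:I (u, v)|lebesgue. \<bar>h' x\<bar>)"
        using set_integral_norm_bound[OF intI[OF uv]] by simp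
      finally show ?thesis .
    qed
    then have "(\<Sum>(u, v)\<in>D. \<bar>h v - h u\<bar>) \<le> (\<Sum>p\<in>D. LINT x:I p|lebesgue. \<bar>h' x\<bar>)"
      by (intro sum_mono) auto
    also have "\<dots> = (LINT x:(\<Union>p\<in>D. I p)|lebesgue. \<bar>h' x\<bar>)"
      by (rule set_integral_finite_Union[symmetric]) (use \<open>finite D\<close> disj intI' in \<open>auto simp: I_def\<close>)
    also have "\<dots> = (LINT x:(\<Union>p\<in>D. I p)|lebesgue. \<bar>indicator {a..b} x *\<^sub>R h' x\<bar>)"
    proof (rule set_lebesgue_integral_cong)
      show "\<forall>x. x \<in> (\<Union>p\<in>D. I p) \<longrightarrow> \<bar>h' x\<bar> = \<bar>indicator {a..b} x *\<^sub>R h' x\<bar>"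
        using sub by fastforce
    qed (use \<open>finite D\<close> in auto)
    also have "\<dots> < \<epsilon>"
    proof (rule \<delta>)
      have "emeasure lebesgue (\<Union>p\<in>D. I p) \<le> (\<Sum>p\<in>D. emeasure lebesgue (I p))"
        by (rule emeasure_subadditive_finite) (use \<open>finite D\<close> in auto)
      also have "\<dots> = (\<Sum>p\<in>D. ennreal (snd p - fst p))"
        by (rule sum.cong) (use D in \<open>auto simp: I_def\<close>)
      also have "\<dots> = ennreal (\<Sum>p\<in>D. snd p - fst p)"
        by (rule sum_ennreal) (use D in auto)
      also have "\<dots> < ennreal \<delta>"
        using len \<open>\<delta> > 0\<close> by (simp add: case_prod_unfold ennreal_less_iff ennreal_lessI)
      finally show "emeasure lebesgue (\<Union>p\<in>D. I p) < ennreal \<delta>" .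
    qed (use \<open>finite D\<close> in auto)
    finally show ?thesis .
  qed
  then show "\<exists>\<delta>>0. \<forall>D. finite D \<longrightarrow> (\<forall>(u, v)\<in>D. a \<le> u \<and> u \<le> v \<and> v \<le> b) \<longrightarrow>
      disjoint_family_on (\<lambda>(u, v). {u<..<v}) D \<longrightarrow> (\<Sum>(u, v)\<in>D. v - u) < \<delta> \<longrightarrow>
      (\<Sum>(u, v)\<in>D. \<bar>h v - h u\<bar>) < \<epsilon>"
    using \<open>\<delta> > 0\<close> by (intro exI[of _ \<delta>]) auto
qed

section \<open>The two-parameter Mittag-Leffler function: convergence and derivative\<close>

text \<open>The Euler integral is cut down to {R..}, where the power is at least its value at R. As
  R is arbitrary, Gamma outgrows every geometric sequence, which is what convergence of the series
  requires.\<close>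

lemma Gamma_real_ge_powr:
  fixes x R :: real
  assumes "x \<ge> 1" "R \<ge> 0"
  shows "Gamma x \<ge> R powr (x - 1) * exp (- R)"
proof (rule has_integral_le)
  have "((\<lambda>t. exp (-1 * t)) has_integral exp (-1 * R) / 1) {R..}"
    by (rule has_integral_exp_minus_to_infinity) auto
  then have "((\<lambda>t. R powr (x - 1) * exp (- t)) has_integral R powr (x - 1) * exp (- R)) {R..}"
    by (intro has_integral_mult_right) simp
  then show "((\<lambda>t. if t \<in> {R..} then R powr (x - 1) * exp (- t) else 0) has_integral
      R powr (x - 1) * exp (- R)) {0..}"
    using assms by (subst has_integral_restrict) auto
  show "((\<lambda>t. t powr (x - 1) / exp t) has_integral Gamma x) {0..}"
    using assms by (intro Gamma_integral_real) auto
  show "(if t \<in> {R..} then R powr (x - 1) * exp (- t) else 0) \<le> t powr (x - 1) / exp t"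
    if "t \<in> {0..}" for t
    using assms that by (auto simp: exp_minus field_simps powr_mono2)
qed

text \<open>The second parameter makes the family \<open>t powr \<beta> * mittag_leffler2 \<alpha>
  (\<beta> + 1) (z * t powr \<alpha>)\<close> stable: differentiation and fractional integration
  merely shift \<beta>.\<close>

definition mittag_leffler2 :: "real \<Rightarrow> real \<Rightarrow> real \<Rightarrow> real" where
  "mittag_leffler2 \<alpha> \<beta> z = (\<Sum>k. z ^ k / Gamma (\<alpha> * real k + \<beta>))"

lemma summable_mittag_leffler2:
  fixes \<alpha> \<beta> z :: real
  assumes "\<alpha> > 0"
  shows "summable (\<lambda>k. z ^ k / Gamma (\<alpha> * real k + \<beta>))"
proof -
  \<comment> \<open>With this R the Gamma bound grows like (2|z| + 1)^k, so the terms have ratio at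
    most 1/2; adding 1 keeps R positive for z = 0.\<close>
  define R where "R = (2 * \<bar>z\<bar> + 1) powr (1 / \<alpha>)"
  have R: "R > 0" "R powr \<alpha> = 2 * \<bar>z\<bar> + 1"
    using assms by (auto simp: R_def powr_powr)
  define C where "C = exp R * R powr (1 - \<beta>)"
  have "filterlim (\<lambda>k. \<alpha> * real k + \<beta>) at_top sequentially"
    using assms by real_asymp
  then have "eventually (\<lambda>k. \<alpha> * real k + \<beta> \<ge> 1) sequentially"
    by (simp add: filterlim_at_top)
  then have "eventually (\<lambda>k. norm (z ^ k / Gamma (\<alpha> * real k + \<beta>)) \<le> C * (1 / 2) ^ k) sequentially"
  proof eventually_elim
    case (elim k)
    have "R powr (\<alpha> * real k + \<beta> - 1) = (2 * \<bar>z\<bar> + 1) ^ k * R powr (\<beta> - 1)"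
    proof -
      have "R powr (\<alpha> * real k + \<beta> - 1) = R powr (\<alpha> * real k) * R powr (\<beta> - 1)"
        by (simp add: powr_add[symmetric] algebra_simps)
      also have "R powr (\<alpha> * real k) = (2 * \<bar>z\<bar> + 1) ^ k"
        using R by (simp add: powr_powr[symmetric] powr_realpow)
      finally show ?thesis .
    qed
    then have "(2 * \<bar>z\<bar> + 1) ^ k / C \<le> Gamma (\<alpha> * real k + \<beta>)"
      using Gamma_real_ge_powr[OF elim, of R] R
      by (simp add: C_def exp_minus field_simps powr_diff)
    moreover have "C > 0" using R by (simp add: C_def)
    moreover have nrm: "norm (z ^ k / Gamma (\<alpha> * real k + \<beta>)) = \<bar>z\<bar> ^ k / Gamma (\<alpha> * real k + \<beta>)"
      using elim Gamma_real_pos[of "\<alpha> * real k + \<beta>"] by (simp add: power_abs)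
    ultimately have "norm (z ^ k / Gamma (\<alpha> * real k + \<beta>)) \<le> \<bar>z\<bar> ^ k / ((2 * \<bar>z\<bar> + 1) ^ k / C)"
      by (subst nrm, intro frac_le) auto
    also have "\<dots> = C * (\<bar>z\<bar> / (2 * \<bar>z\<bar> + 1)) ^ k"
      by (simp add: power_divide)
    also have "\<dots> \<le> C * (1 / 2) ^ k"
      using \<open>C > 0\<close> by (intro mult_left_mono power_mono) (auto simp: field_simps)
    finally show ?case .
  qed
  then show ?thesis
    by (rule summable_comparison_test_ev) (intro summable_mult summable_geometric, simp)
qed

text \<open>Termwise, the exponent \<alpha> k + \<beta> comes down and cancels one factor of
  Gamma(\<alpha> k + \<beta> + 1). The formal argument differentiates the power series in x = z
  t^\<alpha> and then applies the chain and product rules.\<close>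

lemma DERIV_powr_mittag_leffler2:
  fixes \<alpha> \<beta> z t :: real
  assumes "\<alpha> > 0" "\<beta> > 0" "t > 0"
  shows "((\<lambda>t. t powr \<beta> * mittag_leffler2 \<alpha> (\<beta> + 1) (z * t powr \<alpha>)) has_real_derivative
    t powr (\<beta> - 1) * mittag_leffler2 \<alpha> \<beta> (z * t powr \<alpha>)) (at t)"
proof -
  define c where "c k = 1 / Gamma (\<alpha> * real k + (\<beta> + 1))" for k
  define x where "x = z * t powr \<alpha>"
  have sm: "summable (\<lambda>k. c k * y ^ k)" for y
    using summable_mittag_leffler2[OF \<open>\<alpha> > 0\<close>, of y "\<beta> + 1"] by (simp add: c_def)
  have ml: "mittag_leffler2 \<alpha> (\<beta> + 1) = (\<lambda>y. \<Sum>k. c k * y ^ k)"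
    by (simp add: mittag_leffler2_def c_def fun_eq_iff)
  define P' where "P' = (\<Sum>k. diffs c k * x ^ k)"
  have D: "(mittag_leffler2 \<alpha> (\<beta> + 1) has_real_derivative P') (at x)"
    unfolding ml P'_def by (rule termdiffs_strong_converges_everywhere) (rule sm)
  have "(\<lambda>k. diffs c k * x ^ k) sums P'"
    unfolding P'_def by (intro summable_sums termdiff_converges_all sm)
  \<comment> \<open>The factor x undoes the index shift in \<open>diffs\<close>; the term k = 0 of
    the resulting series vanishes, so shifting back adds nothing.\<close>
  then have "(\<lambda>k. (diffs c k * x ^ k) * x) sums (P' * x)" by (rule sums_mult2)
  then have "(\<lambda>k. real (Suc k) * c (Suc k) * x ^ Suc k) sums (P' * x)"
    by (simp add: diffs_def mult_ac)
  then have s1: "(\<lambda>k. real k * c k * x ^ k) sums (P' * x)"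
    by (subst (asm) sums_Suc_iff) simp
  have s2: "(\<lambda>k. c k * x ^ k) sums mittag_leffler2 \<alpha> (\<beta> + 1) x"
    using sm by (simp add: ml summable_sums)
  have "(\<lambda>k. \<beta> * (c k * x ^ k) + \<alpha> * (real k * c k * x ^ k)) sums
      (\<beta> * mittag_leffler2 \<alpha> (\<beta> + 1) x + \<alpha> * (P' * x))"
    by (intro sums_add sums_mult s1 s2)
  moreover have "\<beta> * (c k * x ^ k) + \<alpha> * (real k * c k * x ^ k) = x ^ k / Gamma (\<alpha> * real k + \<beta>)" for k
  proof -
    have pos: "\<alpha> * real k + \<beta> > 0" using assms by (intro add_nonneg_pos) auto
    have "Gamma (\<alpha> * real k + (\<beta> + 1)) = (\<alpha> * real k + \<beta>) * Gamma (\<alpha> * real k + \<beta>)"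
      using Gamma_plus1[of "\<alpha> * real k + \<beta>"] pos nonpos_Ints_nonpos[of "\<alpha> * real k + \<beta>"]
      by (force simp: add.assoc)
    then have "c k * (\<alpha> * real k + \<beta>) = 1 / Gamma (\<alpha> * real k + \<beta>)"
      using pos by (simp add: c_def)
    then have "(\<alpha> * real k + \<beta>) * c k * x ^ k = x ^ k / Gamma (\<alpha> * real k + \<beta>)"
      by (simp add: mult.commute)
    then show ?thesis by (simp add: algebra_simps)
  qed
  ultimately have "(\<lambda>k. x ^ k / Gamma (\<alpha> * real k + \<beta>)) sums
      (\<beta> * mittag_leffler2 \<alpha> (\<beta> + 1) x + \<alpha> * (P' * x))" by simp
  \<comment> \<open>The recurrence that lowers the second parameter; it collapses the two terms of
    the product rule into one.\<close>
  then have eq: "mittag_leffler2 \<alpha> \<beta> x = \<beta> * mittag_leffler2 \<alpha> (\<beta> + 1) x + \<alpha> * (P' * x)"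
    unfolding mittag_leffler2_def by (rule sums_unique[symmetric])
  have "((\<lambda>t. z * t powr \<alpha>) has_real_derivative z * (\<alpha> * t powr (\<alpha> - 1))) (at t)"
    using assms by (auto intro!: derivative_eq_intros)
  from DERIV_chain2[OF D[unfolded x_def] this]
  have "((\<lambda>t. mittag_leffler2 \<alpha> (\<beta> + 1) (z * t powr \<alpha>)) has_real_derivative
      P' * (z * (\<alpha> * t powr (\<alpha> - 1)))) (at t)" .
  from DERIV_mult[OF has_real_derivative_powr[OF \<open>t > 0\<close>, of \<beta>] this]
  have "((\<lambda>t. t powr \<beta> * mittag_leffler2 \<alpha> (\<beta> + 1) (z * t powr \<alpha>)) has_real_derivative
      \<beta> * t powr (\<beta> - 1) * mittag_leffler2 \<alpha> (\<beta> + 1) x + P' * (z * (\<alpha> * t powr (\<alpha> - 1))) * t powr \<beta>) (at t)"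
    by (simp add: x_def)
  also have "\<beta> * t powr (\<beta> - 1) * mittag_leffler2 \<alpha> (\<beta> + 1) x + P' * (z * (\<alpha> * t powr (\<alpha> - 1))) * t powr \<beta> =
      t powr (\<beta> - 1) * mittag_leffler2 \<alpha> \<beta> x"
    unfolding eq using assms by (simp add: x_def powr_diff field_simps)
  finally show ?thesis by (simp add: x_def)
qed

section \<open>Fractional integration of the Mittag-Leffler series\<close>

text \<open>Substitution \<tau> = t s in the Beta integral: the two powers contribute t^(a+b-2) and
  the substitution one more factor t.\<close>

lemma has_integral_Beta_real_scaled:
  fixes a b t :: real
  assumes "a > 0" "b > 0" "t > 0"
  shows "((\<lambda>\<tau>. (t - \<tau>) powr (b - 1) * \<tau> powr (a - 1)) has_integral
    t powr (a + b - 1) * Beta a b) {0..t}"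
proof -
  have "((\<lambda>\<tau>. (1 / t * \<tau>) powr (a - 1) * (1 - 1 / t * \<tau>) powr (b - 1)) has_integral
      (1 / \<bar>1 / t\<bar>) *\<^sub>R Beta a b) ((\<lambda>x. x / (1 / t)) ` {0..1})"
    by (rule has_integral_stretch_real[OF has_integral_Beta_real]) (use assms in auto)
  moreover have "(\<lambda>x. x / (1 / t)) ` {0..1} = {0..t}"
    using assms image_mult_atLeastAtMost[of t 0 1] by (simp add: mult.commute[of _ t])
  ultimately have "((\<lambda>\<tau>. (1 / t * \<tau>) powr (a - 1) * (1 - 1 / t * \<tau>) powr (b - 1)) has_integral t * Beta a b) {0..t}"
    using assms by simp
  then have I: "((\<lambda>\<tau>. t powr (a + b - 2) * ((1 / t * \<tau>) powr (a - 1) * (1 - 1 / t * \<tau>) powr (b - 1))) has_integral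
     t powr (a + b - 2) * (t * Beta a b)) {0..t}"
    by (rule has_integral_mult_right)
  have const: "t powr (a + b - 2) * (t * Beta a b) = t powr (a + b - 1) * Beta a b"
  proof -
    have "t powr (a + b - 1) = t * t powr (a + b - 2)"
      using powr_mult_base[of t "a + b - 2"] assms by (simp add: algebra_simps)
    then show ?thesis by (simp add: mult.commute)
  qed
  have "t powr (a + b - 2) * ((1 / t * \<tau>) powr (a - 1) * (1 - 1 / t * \<tau>) powr (b - 1)) =
      (t - \<tau>) powr (b - 1) * \<tau> powr (a - 1)" if "\<tau> \<in> {0..t}" for \<tau>
  proof -
    have "1 - 1 / t * \<tau> = (t - \<tau>) / t" using assms by (simp add: field_simps)
    moreover have "t powr (a + b - 2) = t powr (a - 1) * t powr (b - 1)"
      by (simp add: powr_add[symmetric])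
    ultimately show ?thesis using that assms by (simp add: powr_divide)
  qed
  from has_integral_eq[OF this I] show ?thesis by (simp only: const)
qed


lemma continuous_on_mittag_leffler2:
  assumes "\<alpha> > 0"
  shows "continuous_on A (mittag_leffler2 \<alpha> \<beta>)"
proof -
  have "isCont (\<lambda>z. \<Sum>k. (1 / Gamma (\<alpha> * real k + \<beta>)) * z ^ k) x" for x
    by (rule isCont_powser_converges_everywhere) (use summable_mittag_leffler2[OF assms] in simp)
  then show ?thesis
    by (auto simp: mittag_leffler2_def[abs_def] intro!: continuous_at_imp_continuous_on)
qed

lemma continuous_on_powr_mittag_leffler2:
  assumes "\<alpha> > 0" "\<beta> > 0"
  shows "continuous_on {0..} (\<lambda>t. t powr \<beta> * mittag_leffler2 \<alpha> b (z * t powr \<alpha>))"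
  using assms
  by (intro continuous_on_mult continuous_on_powr' continuous_intros
      continuous_on_compose2[OF continuous_on_mittag_leffler2[where A = UNIV]]) auto

lemma fractional_integral_powr_mittag_leffler2:
  fixes \<alpha> \<beta> \<gamma> z t :: real
  assumes "\<alpha> > 0" "\<beta> > 0" "\<gamma> < 1" "t > 0"
  defines "p \<equiv> (\<lambda>\<tau>. (t - \<tau>) powr (- \<gamma>) * (\<tau> powr (\<beta> - 1) * mittag_leffler2 \<alpha> \<beta> (z * \<tau> powr \<alpha>)))"
  shows "set_integrable lebesgue {0..t} p"
    and "(LINT \<tau>:{0..t}|lebesgue. p \<tau>) =
      Gamma (1 - \<gamma>) * (t powr (\<beta> - \<gamma>) * mittag_leffler2 \<alpha> (\<beta> - \<gamma> + 1) (z * t powr \<alpha>))"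
proof -
  define a where "a k = \<alpha> * real k + \<beta>" for k
  have a: "a k > 0" for k using assms by (simp add: a_def add_nonneg_pos)
  have Ga: "Gamma (a k) > 0" for k using a by (rule Gamma_real_pos)
  define q where "q k \<tau> = (t - \<tau>) powr (- \<gamma>) * \<tau> powr (a k - 1)" for k \<tau>
  define f where "f k \<tau> = indicator {0..t} \<tau> *\<^sub>R (z ^ k / Gamma (a k) * q k \<tau>)" for k \<tau>
  have qint: "(q k has_integral t powr (a k - \<gamma>) * Beta (a k) (1 - \<gamma>)) {0..t}" for k
    using has_integral_Beta_real_scaled[of "a k" "1 - \<gamma>" t] a[of k] assms
    by (simp add: q_def[abs_def] algebra_simps)
  have qabs: "set_integrable lebesgue {0..t} (q k)" for k
    using qint by (intro nonnegative_absolutely_integrable_1) (auto simp: q_def integrable_on_def)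
  have qL: "(LINT \<tau>:{0..t}|lebesgue. q k \<tau>) = t powr (a k - \<gamma>) * Beta (a k) (1 - \<gamma>)" for k
    using set_lebesgue_integral_eq_integral(2)[OF qabs] qint by (simp add: integral_unique)
  have t_powr: "\<tau> powr (\<alpha> * real k) = (\<tau> powr \<alpha>) ^ k" if "\<tau> > 0" for k and \<tau> :: real
    using that by (simp add: powr_powr[symmetric] powr_realpow)
  \<comment> \<open>The general w serves twice: w = z for the value, w = |z| for the integrals of
    the norms.\<close>
  have coeff: "w ^ k / Gamma (a k) * (t powr (a k - \<gamma>) * Beta (a k) (1 - \<gamma>)) =
      Gamma (1 - \<gamma>) * t powr (\<beta> - \<gamma>) * ((w * t powr \<alpha>) ^ k / Gamma (\<alpha> * real k + (\<beta> - \<gamma> + 1)))" for w k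
  proof -
    have "t powr (a k - \<gamma>) = t powr (\<alpha> * real k) * t powr (\<beta> - \<gamma>)"
      by (simp add: a_def powr_add[symmetric] algebra_simps)
    moreover have "Beta (a k) (1 - \<gamma>) = Gamma (a k) * Gamma (1 - \<gamma>) / Gamma (\<alpha> * real k + (\<beta> - \<gamma> + 1))"
      by (simp add: Beta_def a_def algebra_simps)
    ultimately show ?thesis
      using Ga[of k] assms by (simp add: t_powr power_mult_distrib)
  qed
  have sm: "summable (\<lambda>k. w ^ k / Gamma (a k) * (t powr (a k - \<gamma>) * Beta (a k) (1 - \<gamma>)))" for w
    unfolding coeff using assms by (intro summable_mult summable_mittag_leffler2)
  have fint: "integrable lebesgue (f k)" for k
    using set_integrable_mult_right[OF qabs, of "z ^ k / Gamma (a k)"] by (simp add: f_def[abs_def] set_integrable_def)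
  have fL: "integral\<^sup>L lebesgue (f k) = z ^ k / Gamma (a k) * (t powr (a k - \<gamma>) * Beta (a k) (1 - \<gamma>))" for k
    unfolding qL[symmetric] set_integral_mult_right[symmetric] by (simp only: f_def[abs_def] set_lebesgue_integral_def)
  have fN: "(\<integral>\<tau>. norm (f k \<tau>) \<partial>lebesgue) = \<bar>z\<bar> ^ k / Gamma (a k) * (t powr (a k - \<gamma>) * Beta (a k) (1 - \<gamma>))" for k
  proof -
    have "norm (f k \<tau>) = indicator {0..t} \<tau> *\<^sub>R (\<bar>z\<bar> ^ k / Gamma (a k) * q k \<tau>)" for \<tau>
      using Ga[of k] by (simp add: f_def abs_mult power_abs q_def)
    then show ?thesis
      unfolding qL[symmetric] set_integral_mult_right[symmetric] by (simp only: set_lebesgue_integral_def)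
  qed
  have fsums: "(\<lambda>k. f k \<tau>) sums (indicator {0..t} \<tau> *\<^sub>R p \<tau>)" for \<tau>
  \<comment> \<open>Merging exponents of \<tau> needs \<tau> > 0; at \<tau> = 0 everything vanishes
    because \<open>0 powr x = 0\<close>.\<close>
  proof (cases "\<tau> \<in> {0<..t}")
    case True
    have "(\<lambda>k. (t - \<tau>) powr (- \<gamma>) * \<tau> powr (\<beta> - 1) * ((z * \<tau> powr \<alpha>) ^ k / Gamma (\<alpha> * real k + \<beta>))) sums
        ((t - \<tau>) powr (- \<gamma>) * \<tau> powr (\<beta> - 1) * mittag_leffler2 \<alpha> \<beta> (z * \<tau> powr \<alpha>))"
      unfolding mittag_leffler2_def using assms by (intro sums_mult summable_sums summable_mittag_leffler2)
    moreover have "f k \<tau> = (t - \<tau>) powr (- \<gamma>) * \<tau> powr (\<beta> - 1) * ((z * \<tau> powr \<alpha>) ^ k / Gamma (\<alpha> * real k + \<beta>))" for k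
    proof -
      have "\<tau> powr (a k - 1) = \<tau> powr (\<alpha> * real k) * \<tau> powr (\<beta> - 1)"
        by (simp add: a_def powr_add[symmetric] algebra_simps)
      then show ?thesis
        using True by (simp add: f_def q_def t_powr power_mult_distrib a_def)
    qed
    ultimately show ?thesis using True by (simp add: p_def mult.assoc)
  next
    case False
    then have "\<tau> = 0 \<or> \<tau> \<notin> {0..t}" by auto
    then show ?thesis by (auto simp: f_def p_def q_def)
  qed
  have fabs: "summable (\<lambda>k. norm (f k \<tau>))" for \<tau>
  proof (cases "\<tau> \<in> {0<..t}")
    case True
    have "norm (f k \<tau>) = (t - \<tau>) powr (- \<gamma>) * \<tau> powr (\<beta> - 1) * ((\<bar>z\<bar> * \<tau> powr \<alpha>) ^ k / Gamma (\<alpha> * real k + \<beta>))" for k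
    proof -
      have "\<tau> powr (a k - 1) = \<tau> powr (\<alpha> * real k) * \<tau> powr (\<beta> - 1)"
        by (simp add: a_def powr_add[symmetric] algebra_simps)
      then show ?thesis
        using True Ga[of k] by (simp add: f_def q_def t_powr power_mult_distrib a_def abs_mult power_abs)
    qed
    then show ?thesis
      using assms by (simp only:) (intro summable_mult summable_mittag_leffler2)
  next
    case False
    then have "\<tau> = 0 \<or> \<tau> \<notin> {0..t}" by auto
    then show ?thesis by (auto simp: f_def q_def)
  qed
  have ssum: "(\<lambda>\<tau>. \<Sum>k. f k \<tau>) = (\<lambda>\<tau>. indicator {0..t} \<tau> *\<^sub>R p \<tau>)"
    using fsums by (auto simp: sums_iff)
  have sN: "summable (\<lambda>k. \<integral>\<tau>. norm (f k \<tau>) \<partial>lebesgue)"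
    unfolding fN by (rule sm)
  show "set_integrable lebesgue {0..t} p"
    using integrable_suminf[OF fint AE_I2[OF fabs] sN] by (simp add: ssum set_integrable_def)
  have "(LINT \<tau>:{0..t}|lebesgue. p \<tau>) = (\<Sum>k. integral\<^sup>L lebesgue (f k))"
    using integral_suminf[OF fint AE_I2[OF fabs] sN] by (simp add: ssum set_lebesgue_integral_def)
  also have "\<dots> = Gamma (1 - \<gamma>) * t powr (\<beta> - \<gamma>) * mittag_leffler2 \<alpha> (\<beta> - \<gamma> + 1) (z * t powr \<alpha>)"
    unfolding fL coeff mittag_leffler2_def using assms by (intro suminf_mult summable_mittag_leffler2)
  finally show "(LINT \<tau>:{0..t}|lebesgue. p \<tau>) =
      Gamma (1 - \<gamma>) * (t powr (\<beta> - \<gamma>) * mittag_leffler2 \<alpha> (\<beta> - \<gamma> + 1) (z * t powr \<alpha>))"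
    by (simp add: mult.assoc)
qed

lemma mittag_leffler2_0: "mittag_leffler2 \<alpha> \<beta> 0 = 1 / Gamma \<beta>"
  unfolding mittag_leffler2_def using powser_zero[of "\<lambda>k. 1 / Gamma (\<alpha> * real k + \<beta>)"] by simp

text \<open>Splitting off the term k = 0 isolates the constant that the Caputo derivative
  annihilates; with z = \<lambda> t^\<alpha> the rest belongs to the stable family with \<beta> =
  \<alpha>.\<close>

lemma mittag_leffler_eq_mittag_leffler2:
  fixes z :: real
  assumes "\<alpha> > 0"
  shows "mittag_leffler \<alpha> z = 1 + z * mittag_leffler2 \<alpha> (\<alpha> + 1) z"
proof -
  have "(\<lambda>k. z * (z ^ k / Gamma (\<alpha> * real k + (\<alpha> + 1)))) sums (z * mittag_leffler2 \<alpha> (\<alpha> + 1) z)"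
    unfolding mittag_leffler2_def using assms
    by (intro sums_mult summable_sums summable_mittag_leffler2)
  then have "(\<lambda>k. z ^ Suc k / Gamma (\<alpha> * real (Suc k) + 1)) sums (z * mittag_leffler2 \<alpha> (\<alpha> + 1) z)"
    by (simp add: algebra_simps)
  from sums_Suc[OF this] show ?thesis
    unfolding mittag_leffler_def by (simp add: sums_iff add.commute)
qed

section \<open>Caputo derivatives of a constant plus a member of the stable family\<close>

context
  fixes \<alpha> \<beta> c d z :: real and h :: "real \<Rightarrow> real"
  assumes \<alpha>: "\<alpha> > 0" and \<beta>: "\<beta> > 0"
    and h: "\<And>t. t \<ge> 0 \<Longrightarrow> h t = c + d * (t powr \<beta> * mittag_leffler2 \<alpha> (\<beta> + 1) (z * t powr \<alpha>))"
begin

lemma DERIV_affine_powr_mittag_leffler2: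
  assumes "t > 0"
  shows "(h has_real_derivative d * (t powr (\<beta> - 1) * mittag_leffler2 \<alpha> \<beta> (z * t powr \<alpha>))) (at t)"
proof (rule has_field_derivative_transform_within_open)
  show "((\<lambda>t. c + d * (t powr \<beta> * mittag_leffler2 \<alpha> (\<beta> + 1) (z * t powr \<alpha>))) has_real_derivative
      d * (t powr (\<beta> - 1) * mittag_leffler2 \<alpha> \<beta> (z * t powr \<alpha>))) (at t)"
    using DERIV_add[OF DERIV_const[of c] DERIV_cmult[OF DERIV_powr_mittag_leffler2[OF \<alpha> \<beta> assms, of z], of d]]
    by simp
  show "open {0::real<..}" "t \<in> {0<..}" using assms by auto
qed (simp add: h)

lemma continuous_on_affine_powr_mittag_leffler2: "continuous_on {0..} h"
proof -
  have "continuous_on {0..} (\<lambda>t. c + d * (t powr \<beta> * mittag_leffler2 \<alpha> (\<beta> + 1) (z * t powr \<alpha>)))"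
    using \<alpha> \<beta> by (intro continuous_intros continuous_on_powr_mittag_leffler2)
  then show ?thesis by (rule continuous_on_eq) (simp add: h)
qed

text \<open>Differentiation removes \<open>c\<close>, and the fractional integral of the rest lowers
  \<beta> by \<gamma>. Both the original function (c = 1) and its extended Caputo derivative (c = 0)
  are instances, so the lemma serves both stages of a composition.\<close>

lemma caputo_affine_powr_mittag_leffler2:
  assumes "\<gamma> < 1"
  shows "caputo_exists \<gamma> h"
    and "t > 0 \<Longrightarrow> caputo \<gamma> h t = d * (t powr (\<beta> - \<gamma>) * mittag_leffler2 \<alpha> (\<beta> - \<gamma> + 1) (z * t powr \<alpha>))"
proof -
  define h' where "h' t = d * (t powr (\<beta> - 1) * mittag_leffler2 \<alpha> \<beta> (z * t powr \<alpha>))" for t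
  have deriv_h: "deriv h t = h' t" if "t > 0" for t
    unfolding h'_def by (rule DERIV_imp_deriv) (rule DERIV_affine_powr_mittag_leffler2[OF that])
  define p where "p \<gamma> t \<tau> = (t - \<tau>) powr (- \<gamma>) * (\<tau> powr (\<beta> - 1) * mittag_leffler2 \<alpha> \<beta> (z * \<tau> powr \<alpha>))" for \<gamma> t \<tau>
  have p: "set_integrable lebesgue {0..t} (\<lambda>\<tau>. d * p \<gamma> t \<tau>)" if "\<gamma> < 1" "t > 0" for \<gamma> t
    unfolding p_def using fractional_integral_powr_mittag_leffler2(1)[OF \<alpha> \<beta> that]
    by (intro set_integrable_mult_right) auto
  have int: "set_integrable lebesgue {0..t} (\<lambda>\<tau>. (t - \<tau>) powr (- \<gamma>) * deriv h \<tau>)" if "t > 0" for t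
    \<comment> \<open>The value of \<open>deriv h\<close> at 0 is uncontrolled, but a single point
      is negligible.\<close>
    by (rule absolutely_integrable_spike[OF p[OF \<open>\<gamma> < 1\<close> that], of "{0}"])
       (auto simp: p_def deriv_h h'_def)
  have "abs_continuous_on 0 T h" if "T > 0" for T
  proof (rule abs_continuous_on_integrable_deriv)
    show "continuous_on {0..T} h"
      by (rule continuous_on_subset[OF continuous_on_affine_powr_mittag_leffler2]) auto
    show "(h has_real_derivative h' x) (at x)" if "x \<in> {0<..<T}" for x
      using DERIV_affine_powr_mittag_leffler2[of x] that by (simp add: h'_def)
    show "set_integrable lebesgue {0..T} h'"
      \<comment> \<open>For order 0 the kernel is 1 except at \<tau> = T, where
        \<open>0 powr 0 = 0\<close>; hence the exceptional set {T}.\<close>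
      by (rule absolutely_integrable_spike[OF p[of 0, OF _ that], of "{T}"]) (auto simp: p_def h'_def)
  qed
  then show "caputo_exists \<gamma> h"
    using int continuous_on_affine_powr_mittag_leffler2
    by (auto simp: caputo_exists_def caputo_admissible_def)
  show "caputo \<gamma> h t = d * (t powr (\<beta> - \<gamma>) * mittag_leffler2 \<alpha> (\<beta> - \<gamma> + 1) (z * t powr \<alpha>))" if "t > 0"
  proof -
    have Gamma_nz: "Gamma (1 - \<gamma>) \<noteq> 0"
      using Gamma_real_pos[of "1 - \<gamma>"] \<open>\<gamma> < 1\<close> by fastforce
    have "(LINT \<tau>:{0..t}|lebesgue. (t - \<tau>) powr (- \<gamma>) * deriv h \<tau>) = (LINT \<tau>:{0..t}|lebesgue. d * p \<gamma> t \<tau>)"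
      unfolding set_lebesgue_integral_eq_integral(2)[OF int[OF that]]
        set_lebesgue_integral_eq_integral(2)[OF p[OF \<open>\<gamma> < 1\<close> that]]
      by (rule integral_spike[of "{0}"]) (auto simp: p_def deriv_h h'_def)
    also have "\<dots> = d * (Gamma (1 - \<gamma>) * (t powr (\<beta> - \<gamma>) * mittag_leffler2 \<alpha> (\<beta> - \<gamma> + 1) (z * t powr \<alpha>)))"
      unfolding p_def set_integral_mult_right
        fractional_integral_powr_mittag_leffler2(2)[OF \<alpha> \<beta> \<open>\<gamma> < 1\<close> that] ..
    finally show ?thesis using Gamma_nz by (simp add: caputo_def)
  qed
qed

text \<open>Since \<beta> - \<gamma> > 0, the closed form is continuous with value 0 at 0, and this
  is the limit that \<open>extend0\<close> inserts. The extension therefore again has the shape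
  required of \<open>h\<close>, without a constant.\<close>

lemma extend0_caputo_powr_mittag_leffler2:
  assumes "\<gamma> < 1" "\<gamma> < \<beta>" "t \<ge> 0"
  shows "extend0 (caputo \<gamma> h) t =
    d * (t powr (\<beta> - \<gamma>) * mittag_leffler2 \<alpha> (\<beta> - \<gamma> + 1) (z * t powr \<alpha>))"
proof (cases "t = 0")
  case True
  define g where "g t = d * (t powr (\<beta> - \<gamma>) * mittag_leffler2 \<alpha> (\<beta> - \<gamma> + 1) (z * t powr \<alpha>))" for t
  have "continuous_on {0..} g"
    unfolding g_def using \<alpha> assms by (intro continuous_intros continuous_on_powr_mittag_leffler2) auto
  then have "(g \<longlongrightarrow> g 0) (at 0 within {0..})" by (simp add: continuous_on_def)
  then have "(g \<longlongrightarrow> g 0) (at_right 0)" by (rule tendsto_within_subset) auto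
  moreover have "g 0 = 0" by (simp add: g_def)
  ultimately have "(g \<longlongrightarrow> 0) (at_right 0)" by simp
  moreover have "eventually (\<lambda>t. g t = caputo \<gamma> h t) (at_right 0)"
    using caputo_affine_powr_mittag_leffler2(2)[OF \<open>\<gamma> < 1\<close>]
    by (auto simp: g_def eventually_at_right_less eventually_at_filter)
  ultimately have "(caputo \<gamma> h \<longlongrightarrow> 0) (at_right 0)"
    by (rule Lim_transform_eventually)
  then show ?thesis using True by (simp add: extend0_def tendsto_Lim)
qed (use assms caputo_affine_powr_mittag_leffler2(2) in \<open>simp add: extend0_def\<close>)

end

section \<open>Failure of differentiability at 0, and the composition rule\<close>

text \<open>If the difference quotient at 0 had a limit, its product with t^(1-\<alpha>) would tend
  to 0. That product equals z E(z t^\<alpha>) with E =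
  \<open>mittag_leffler2 \<alpha> (\<alpha> + 1)\<close>, which tends to z / Gamma(\<alpha> + 1), a
  nonzero number.\<close>

lemma mittag_leffler_powr_not_C1:
  fixes \<alpha> z T :: real
  assumes "0 < \<alpha>" "\<alpha> < 1" "z \<noteq> 0" "T > 0"
  shows "\<not> C1_on 0 T (\<lambda>t. mittag_leffler \<alpha> (z * t powr \<alpha>))"
proof
  define f where "f t = mittag_leffler \<alpha> (z * t powr \<alpha>)" for t
  define m where "m t = mittag_leffler2 \<alpha> (\<alpha> + 1) (z * t powr \<alpha>)" for t
  have f: "f t = 1 + z * t powr \<alpha> * m t" for t
    using assms by (simp add: f_def m_def mittag_leffler_eq_mittag_leffler2)
  assume "C1_on 0 T (\<lambda>t. mittag_leffler \<alpha> (z * t powr \<alpha>))"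
  then obtain L where "(f has_real_derivative L) (at 0 within {0..T})"
    using \<open>T > 0\<close> by (force simp: C1_on_def f_def[abs_def])
  then have "((\<lambda>t. (f t - f 0) / (t - 0)) \<longlongrightarrow> L) (at_right 0)"
    using \<open>T > 0\<close> by (simp add: has_field_derivative_iff at_within_Icc_at_right)
  moreover have "((\<lambda>t. t powr (1 - \<alpha>)) \<longlongrightarrow> 0 powr (1 - \<alpha>)) (at_right 0)"
    using assms by (intro tendsto_powr' tendsto_intros) (auto simp: eventually_at_filter)
  ultimately have "((\<lambda>t. (f t - f 0) / (t - 0) * t powr (1 - \<alpha>)) \<longlongrightarrow> L * 0 powr (1 - \<alpha>)) (at_right 0)"
    by (rule tendsto_mult)
  moreover have "eventually (\<lambda>t. (f t - f 0) / (t - 0) * t powr (1 - \<alpha>) = z * m t) (at_right 0)"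
    by (auto simp: eventually_at_filter f powr_diff intro!: always_eventually)
  ultimately have "((\<lambda>t. z * m t) \<longlongrightarrow> 0) (at_right 0)"
    by (auto intro: Lim_transform_eventually)
  moreover have "((\<lambda>t. z * m t) \<longlongrightarrow> z * m 0) (at_right 0)"
  proof -
    have "continuous_on {0..} m"
      unfolding m_def using assms
      by (intro continuous_on_compose2[OF continuous_on_mittag_leffler2[where A = UNIV]]
        continuous_on_powr' continuous_intros) auto
    then have "(m \<longlongrightarrow> m 0) (at 0 within {0..})" by (simp add: continuous_on_def)
    then have "(m \<longlongrightarrow> m 0) (at_right 0)"
      by (rule tendsto_within_subset) auto
    then show ?thesis by (intro tendsto_intros)
  qed
  ultimately have "z * m 0 = 0" by (metis tendsto_unique trivial_limit_at_right_real)
  then show False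
    using assms Gamma_real_pos[of "\<alpha> + 1"] by (simp add: m_def mittag_leffler2_0)
qed

theorem theorem4p2:
  fixes lam \<alpha>\<^sub>1 \<alpha>\<^sub>2 \<alpha> :: real and f :: "real \<Rightarrow> real"
  assumes "lam \<noteq> 0"
    and "\<alpha>\<^sub>1 > 0" and "\<alpha>\<^sub>2 > 0"
    and "0 < \<alpha>\<^sub>1 + \<alpha>\<^sub>2" and "\<alpha>\<^sub>1 + \<alpha>\<^sub>2 \<le> \<alpha>" and "\<alpha> < 1"
  defines "f \<equiv> (\<lambda>t. mittag_leffler \<alpha> (lam * t powr \<alpha>))"
  shows "caputo_exists \<alpha>\<^sub>1 f \<and> caputo_exists \<alpha>\<^sub>2 f \<and> caputo_exists (\<alpha>\<^sub>1 + \<alpha>\<^sub>2) f \<and>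
         caputo_exists \<alpha>\<^sub>1 (extend0 (caputo \<alpha>\<^sub>2 f)) \<and>
         caputo_exists \<alpha>\<^sub>2 (extend0 (caputo \<alpha>\<^sub>1 f)) \<and>
         (\<forall>t>0. caputo \<alpha>\<^sub>1 (extend0 (caputo \<alpha>\<^sub>2 f)) t = caputo (\<alpha>\<^sub>1 + \<alpha>\<^sub>2) f t \<and>
                caputo (\<alpha>\<^sub>1 + \<alpha>\<^sub>2) f t = caputo \<alpha>\<^sub>2 (extend0 (caputo \<alpha>\<^sub>1 f)) t) \<and>
         \<not> (\<exists>T>0. C1_on 0 T f)"
proof -
  have \<alpha>: "\<alpha> > 0" using assms by linarith
  have f: "f t = 1 + lam * (t powr \<alpha> * mittag_leffler2 \<alpha> (\<alpha> + 1) (lam * t powr \<alpha>))" for t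
    using mittag_leffler_eq_mittag_leffler2[OF \<alpha>] by (simp add: f_def)
  note cap_f = caputo_affine_powr_mittag_leffler2[OF \<alpha> \<alpha> f]
  \<comment> \<open>Arbitrary orders cover both sides of the theorem at once. In the boundary case
    \<gamma> + \<gamma>' = \<alpha> the final exponent is 0, which is harmless: only the inner
    derivative has to be extended to 0, and its exponent \<alpha> - \<gamma>' is positive.\<close>
  have composition: "caputo_exists \<gamma> (extend0 (caputo \<gamma>' f)) \<and>
      (\<forall>t>0. caputo \<gamma> (extend0 (caputo \<gamma>' f)) t = caputo (\<gamma> + \<gamma>') f t)"
    if "0 < \<gamma>" "0 < \<gamma>'" "\<gamma> + \<gamma>' \<le> \<alpha>" for \<gamma> \<gamma>'
  proof -
    have less: "\<gamma> < 1" "\<gamma>' < 1" "\<gamma>' < \<alpha>" "\<gamma> + \<gamma>' < 1" "0 < \<alpha> - \<gamma>'" using that \<open>\<alpha> < 1\<close> by auto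
    \<comment> \<open>The summand 0 plays the constant \<open>c\<close>, so that the equation
      matches the hypothesis on \<open>h\<close> with \<alpha> - \<gamma>' for \<beta>.\<close>
    have "extend0 (caputo \<gamma>' f) t =
        0 + lam * (t powr (\<alpha> - \<gamma>') * mittag_leffler2 \<alpha> (\<alpha> - \<gamma>' + 1) (lam * t powr \<alpha>))" if "t \<ge> 0" for t
      using extend0_caputo_powr_mittag_leffler2[OF \<alpha> \<alpha> f less(2,3) that] by simp
    note cap_ext = caputo_affine_powr_mittag_leffler2[OF \<alpha> less(5) this less(1)]
    show ?thesis
      using cap_ext cap_f(2)[OF less(4)] by (auto simp: algebra_simps)
  qed
  have "\<not> (\<exists>T>0. C1_on 0 T f)"
    using mittag_leffler_powr_not_C1[OF \<alpha>] assms by (auto simp: f_def)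
  then show ?thesis
    using composition[of \<alpha>\<^sub>1 \<alpha>\<^sub>2] composition[of \<alpha>\<^sub>2 \<alpha>\<^sub>1] cap_f(1) assms
    by (auto simp: add.commute)
qed

end
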